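(* Let $(X,\|\cdot\|)$ be a real reflexive Banach space, let $n\ge2$, let $v_1,\ldots,v_n\in X$ be distinct vectors, let $|||\cdot|||$ be a norm on $X^n$, and let $f(u):=|||(u-v_1,\ldots,u-v_n)|||$ for $u\in X$. Suppose that $f(u)\to\infty$ as $\|u\|\to\infty$, and that there is $\gamma>0$ such that $|||(u,\ldots,u)|||\le\gamma\|u\|$ for all $u\in X$. Then the set of all global minimizers of $f$ over $X$ is nonempty, closed and convex. Moreover, if $f$ is strictly convex, then this set is a singleton.
   Context: A convex function $f:X\to\mathbb{R}$ is strictly convex if $f(\lambda x+(1-\lambda)y)<\lambda f(x)+(1-\lambda)f(y)$ for all distinct $x,y\in X$ and all $\lambda\in(0,1)$. *)

theory Defs
  imports "HOL-Analysis.Analysis"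
begin

text \<open>The canonical map of a real normed space into its bidual, where the dual is the space
  of bounded linear functionals with the operator norm.\<close>

definition canonical_embedding ::
    "'a::real_normed_vector \<Rightarrow> (('a \<Rightarrow>\<^sub>L real) \<Rightarrow>\<^sub>L real)"
  where "canonical_embedding x = Blinfun (\<lambda>g. blinfun_apply g x)"

lemma canonical_embedding_apply [simp]:
  "blinfun_apply (canonical_embedding x) g = blinfun_apply g x"
  unfolding canonical_embedding_def
  by (simp add: bounded_linear_Blinfun_apply blinfun.bounded_linear_left)

text \<open>The canonical map is always a linear isometry into the bidual, so surjectivity is what
  reflexivity asks for. The argument only carries the type of the space.\<close>

definition reflexive_space :: "'a::real_normed_vector itself \<Rightarrow> bool"
  where "reflexive_space _ \<longleftrightarrow>
    surj (canonical_embedding :: 'a \<Rightarrow> (('a \<Rightarrow>\<^sub>L real) \<Rightarrow>\<^sub>L real))"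

text \<open>An arbitrary norm on a real vector space, which need not be related to the one of the
  type class \<^class>\<open>real_normed_vector\<close>.\<close>

definition is_norm :: "('b::real_vector \<Rightarrow> real) \<Rightarrow> bool"
  where "is_norm N \<longleftrightarrow>
    (\<forall>x. 0 \<le> N x) \<and>
    (\<forall>x. N x = 0 \<longleftrightarrow> x = 0) \<and>
    (\<forall>c x. N (c *\<^sub>R x) = \<bar>c\<bar> * N x) \<and>
    (\<forall>x y. N (x + y) \<le> N x + N y)"

definition strictly_convex_on :: "'a::real_vector set \<Rightarrow> ('a \<Rightarrow> real) \<Rightarrow> bool"
  where "strictly_convex_on S f \<longleftrightarrow> convex_on S f \<and>
    (\<forall>x\<in>S. \<forall>y\<in>S. \<forall>t\<in>{0<..<1}. x \<noteq> y \<longrightarrow>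
      f (t *\<^sub>R x + (1 - t) *\<^sub>R y) < t * f x + (1 - t) * f y)"

definition global_minimizers :: "('a \<Rightarrow> real) \<Rightarrow> 'a set"
  where "global_minimizers f = {u. \<forall>w. f u \<le> f w}"

end

theory Submission
  imports Defs
begin

text \<open>A minimizing sequence is bounded by coercivity. On the dual, the functional taking \<open>g\<close> to the
  upper limit of \<open>g\<close> along the sequence is sublinear, so by Hahn-Banach it dominates a bounded
  linear functional, which by reflexivity is evaluation at a point \<open>x\<close>. A norming functional of
  \<open>(x - v\<^sub>1, \<dots>, x - v\<^sub>n)\<close> restricted to the diagonal is a bounded subgradient of \<open>f\<close> at \<open>x\<close>, and
  the subgradient inequality along the sequence shows that \<open>x\<close> is a minimizer. This avoids weak
  topologies altogether.\<close>

section \<open>Sublinear functionals and the Hahn-Banach theorem\<close>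

text \<open>Requiring only an inequality for positive factors is enough: equality follows by rescaling
  back, and the value at zero is then forced to be zero.\<close>

definition sublinear :: "('a::real_vector \<Rightarrow> real) \<Rightarrow> bool" where
  "sublinear p \<longleftrightarrow> (\<forall>x y. p (x + y) \<le> p x + p y) \<and> (\<forall>c>0. \<forall>x. p (c *\<^sub>R x) \<le> c * p x)"

lemma sublinear_add: "sublinear p \<Longrightarrow> p (x + y) \<le> p x + p y"
  by (simp add: sublinear_def)

lemma sublinear_scaleR:
  assumes "sublinear p" "c > 0"
  shows "p (c *\<^sub>R x) = c * p x"
proof (rule antisym)
  show "p (c *\<^sub>R x) \<le> c * p x"
    using assms by (simp add: sublinear_def)
  have "p (inverse c *\<^sub>R (c *\<^sub>R x)) \<le> inverse c * p (c *\<^sub>R x)"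
    using assms unfolding sublinear_def by (meson positive_imp_inverse_positive)
  then show "c * p x \<le> p (c *\<^sub>R x)"
    using assms(2) by (simp add: field_simps)
qed

lemma sublinear_zero: "sublinear p \<Longrightarrow> p 0 = 0"
  using sublinear_scaleR[of p 2 0] by simp

lemma sublinear_minus: "sublinear p \<Longrightarrow> - p (- x) \<le> p x"
  using sublinear_add[of p x "- x"] sublinear_zero[of p] by simp

text \<open>Common source of the sublinear functionals built below. Since only infima are compared,
  a sum or positive multiple of members need only have some member of the target set below
  it.\<close>

lemma sublinear_Inf:
  fixes S :: "'a::real_vector \<Rightarrow> real set"
  assumes ne: "\<And>x. S x \<noteq> {}" and bdd: "\<And>x. bdd_below (S x)"
    and add: "\<And>x y a b. a \<in> S x \<Longrightarrow> b \<in> S y \<Longrightarrow> \<exists>d\<in>S (x + y). d \<le> a + b"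
    and scale: "\<And>x a c. a \<in> S x \<Longrightarrow> c > 0 \<Longrightarrow> \<exists>d\<in>S (c *\<^sub>R x). d \<le> c * a"
  shows "sublinear (\<lambda>x. Inf (S x))"
  unfolding sublinear_def
proof (intro conjI allI impI)
  fix x y
  have *: "Inf (S (x + y)) \<le> a + b" if "a \<in> S x" "b \<in> S y" for a b
    using add[OF that] bdd cInf_lower2 by blast
  \<comment> \<open>The infimum is taken over \<open>a\<close> with \<open>b\<close> fixed, and then
    over \<open>b\<close>.\<close>
  have "Inf (S (x + y)) - b \<le> Inf (S x)" if "b \<in> S y" for b
    using *[OF _ that] ne by (intro cInf_greatest) (auto simp: algebra_simps)
  then have "Inf (S (x + y)) - Inf (S x) \<le> Inf (S y)"
    using ne by (intro cInf_greatest) (auto simp: algebra_simps)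
  then show "Inf (S (x + y)) \<le> Inf (S x) + Inf (S y)"
    by simp
next
  fix c :: real and x
  assume c: "c > 0"
  have "Inf (S (c *\<^sub>R x)) \<le> c * a" if "a \<in> S x" for a
    using scale[OF that c] bdd cInf_lower2 by blast
  then have "Inf (S (c *\<^sub>R x)) / c \<le> Inf (S x)"
    using ne c by (intro cInf_greatest) (auto simp: field_simps)
  then show "Inf (S (c *\<^sub>R x)) \<le> c * Inf (S x)"
    using c by (simp add: field_simps)
qed

text \<open>The witness is \<open>q x = Inf (S x)\<close>. Its bound at \<open>- y\<close> forces
  every linear functional below \<open>q\<close> to take the value \<open>p y\<close> at
  \<open>y\<close>.\<close>

lemma sublinear_peak:
  fixes p :: "'a::real_vector \<Rightarrow> real"
  assumes p: "sublinear p"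
  obtains q where "sublinear q" "q \<le> p" "q (- y) \<le> - p y"
proof -
  define S where "S x = {p (x + t *\<^sub>R y) - t * p y |t. t \<ge> 0}" for x
  have ne: "S x \<noteq> {}" for x
    unfolding S_def by (auto intro: exI[of _ 0])
  have bdd: "bdd_below (S x)" for x
  proof (rule bdd_belowI)
    fix a assume "a \<in> S x"
    then obtain t where t: "t \<ge> 0" "a = p (x + t *\<^sub>R y) - t * p y"
      by (auto simp: S_def)
    \<comment> \<open>Splitting \<open>t *\<^sub>R y\<close> into \<open>x + t *\<^sub>R y\<close>
      and \<open>- x\<close> gives a lower bound free of \<open>t\<close>.\<close>
    have "t * p y = p (t *\<^sub>R y)"
      using t sublinear_scaleR[OF p, of t y] sublinear_zero[OF p] by (cases "t = 0") auto
    also have "\<dots> \<le> p (x + t *\<^sub>R y) + p (- x)"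
      using sublinear_add[OF p, of "x + t *\<^sub>R y" "- x"] by simp
    finally show "- p (- x) \<le> a"
      using t by simp
  qed
  have "sublinear (\<lambda>x. Inf (S x))"
  proof (rule sublinear_Inf[OF ne bdd])
    fix x z a b assume "a \<in> S x" "b \<in> S z"
    then obtain s t where "s \<ge> 0" "a = p (x + s *\<^sub>R y) - s * p y"
      "t \<ge> 0" "b = p (z + t *\<^sub>R y) - t * p y"
      by (auto simp: S_def)
    then show "\<exists>d\<in>S (x + z). d \<le> a + b"
      using sublinear_add[OF p, of "x + s *\<^sub>R y" "z + t *\<^sub>R y"]
      by (intro bexI[of _ "p (x + z + (s + t) *\<^sub>R y) - (s + t) * p y"])
        (auto simp: S_def algebra_simps intro!: exI[of _ "s + t"])
  next
    fix x a c assume "a \<in> S x" "(c::real) > 0"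
    then obtain t where t: "t \<ge> 0" "a = p (x + t *\<^sub>R y) - t * p y"
      by (auto simp: S_def)
    have "c * a = p (c *\<^sub>R x + (c * t) *\<^sub>R y) - (c * t) * p y"
      using sublinear_scaleR[OF p \<open>c > 0\<close>, of "x + t *\<^sub>R y"]
      by (simp add: t(2) right_diff_distrib scaleR_add_right mult.assoc)
    moreover have "c * t \<ge> 0"
      using t \<open>c > 0\<close> by simp
    ultimately show "\<exists>d\<in>S (c *\<^sub>R x). d \<le> c * a"
      unfolding S_def by blast
  qed
  \<comment> \<open>The parameter \<open>t = 0\<close> gives the bound by \<open>p\<close>; below,
    \<open>t = 1\<close> at \<open>- y\<close> gives \<open>p 0 - p y\<close>.\<close>
  moreover have "(\<lambda>x. Inf (S x)) \<le> p"
    by (rule le_funI, rule cInf_lower[OF _ bdd]) (auto simp: S_def intro: exI[of _ 0])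
  moreover have "Inf (S (- y)) \<le> - p y"
    using sublinear_zero[OF p]
    by (intro cInf_lower[OF _ bdd]) (auto simp: S_def intro: exI[of _ 1])
  ultimately show thesis
    using that by blast
qed

text \<open>A minimal \<open>p\<close> coincides with each functional from
  \<open>sublinear_peak\<close>, so it is odd; subadditivity at negated arguments then yields the
  reverse inequality.\<close>

lemma minimal_sublinear_linear:
  fixes p :: "'a::real_vector \<Rightarrow> real"
  assumes p: "sublinear p" and minimal: "\<And>q. sublinear q \<Longrightarrow> q \<le> p \<Longrightarrow> q = p"
  shows "linear p"
proof -
  have odd: "p (- y) = - p y" for y
  proof -
    obtain q where "sublinear q" "q \<le> p" "q (- y) \<le> - p y"
      using sublinear_peak[OF p] by blast
    then have "p (- y) \<le> - p y"
      using minimal by blast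
    then show ?thesis
      using sublinear_minus[OF p, of y] by simp
  qed
  show ?thesis
  proof
    fix x y
    have "p (- x + - y) \<le> p (- x) + p (- y)"
      by (rule sublinear_add[OF p])
    then have "- p (x + y) \<le> - p x - p y"
      using odd[of "x + y"] by (simp add: odd)
    then show "p (x + y) = p x + p y"
      using sublinear_add[OF p, of x y] by simp
  next
    fix c :: real and x
    consider "c > 0" | "c = 0" | "- c > 0"
      by linarith
    then show "p (c *\<^sub>R x) = c *\<^sub>R p x"
    proof cases
      case 3
      then show ?thesis
        using sublinear_scaleR[OF p 3, of x] odd[of "c *\<^sub>R x"] by simp
    qed (auto simp: sublinear_scaleR[OF p] sublinear_zero[OF p])
  qed
qed

text \<open>Hahn-Banach with Zorn's lemma applied to the sublinear functionals below
  \<open>p\<close> instead of to partial linear extensions: a minimal one is linear.\<close>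

lemma sublinear_dominates_linear:
  fixes p :: "'a::real_vector \<Rightarrow> real"
  assumes p: "sublinear p"
  obtains L where "linear L" "L \<le> p"
proof -
  define A where "A = {q. sublinear q \<and> q \<le> p}"
  have "\<exists>m\<in>A. \<forall>a\<in>A. a \<le> m \<longrightarrow> a = m"
  proof (rule predicate_Zorn)
    \<comment> \<open>The order is reversed, so the maximal element from Zorn's lemma is minimal for
      \<le>.\<close>
    show "partial_order_on A (relation_of (\<lambda>a b. b \<le> a) A)"
      by (rule partial_order_on_relation_ofI) auto
  next
    fix C assume "C \<in> Chains (relation_of (\<lambda>a b. b \<le> a) A)"
    then have CA: "C \<subseteq> A" and chain: "\<And>a b. a \<in> C \<Longrightarrow> b \<in> C \<Longrightarrow> a \<le> b \<or> b \<le> a"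
      by (auto simp: Chains_def relation_of_def)
    show "\<exists>u\<in>A. \<forall>a\<in>C. u \<le> a"
    proof (cases "C = {}")
      case True
      then show ?thesis
        using p by (auto simp: A_def)
    next
      case False
      \<comment> \<open>The bound \<open>- p (- x)\<close> is the same for all members of the chain,
        so the pointwise infimum is finite.\<close>
      have bdd: "bdd_below ((\<lambda>q. q x) ` C)" for x
      proof (rule bdd_belowI2)
        fix q assume "q \<in> C"
        then have "sublinear q" "q (- x) \<le> p (- x)"
          using CA by (auto simp: A_def le_fun_def)
        then show "- p (- x) \<le> q x"
          using sublinear_minus[of q x] by linarith
      qed
      have "sublinear (\<lambda>x. INF q\<in>C. q x)"
      proof (rule sublinear_Inf)
        fix x y a b assume "a \<in> (\<lambda>q. q x) ` C" "b \<in> (\<lambda>q. q y) ` C"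
        then obtain q r where qr: "q \<in> C" "r \<in> C" "a = q x" "b = r y"
          by auto
        \<comment> \<open>The values \<open>a\<close> and \<open>b\<close> may come from different
          members; the smaller member serves both.\<close>
        obtain s where s: "s \<in> C" "s \<le> q" "s \<le> r"
          using chain[OF qr(1,2)] qr(1,2) by auto
        then have "s (x + y) \<le> s x + s y" "s x \<le> q x" "s y \<le> r y"
          using CA by (auto simp: A_def le_fun_def intro: sublinear_add)
        then show "\<exists>d\<in>(\<lambda>q. q (x + y)) ` C. d \<le> a + b"
          using qr s(1) by (intro bexI[of _ "s (x + y)"]) auto
      next
        fix x a c assume "a \<in> (\<lambda>q. q x) ` C" "(c::real) > 0"
        then show "\<exists>d\<in>(\<lambda>q. q (c *\<^sub>R x)) ` C. d \<le> c * a"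
          using CA by (auto simp: A_def sublinear_def)
      qed (use False bdd in auto)
      moreover have low: "(\<lambda>x. INF q\<in>C. q x) \<le> q" if "q \<in> C" for q
        using that by (intro le_funI cINF_lower bdd)
      moreover have "(\<lambda>x. INF q\<in>C. q x) \<le> p"
        using False low CA unfolding A_def by (blast intro: order_trans)
      ultimately show ?thesis
        unfolding A_def by blast
    qed
  qed
  then obtain m where m: "m \<in> A" "\<And>a. a \<in> A \<Longrightarrow> a \<le> m \<Longrightarrow> a = m"
    by blast
  then have "linear m"
    by (intro minimal_sublinear_linear) (auto simp: A_def intro: order_trans)
  then show thesis
    using that m(1) by (auto simp: A_def)
qed

text \<open>Domination is applied to the functional peaked at \<open>y\<close>, which pins the value
  there. For a norm this yields norming functionals.\<close>

lemma sublinear_supporting_linear: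
  fixes p :: "'a::real_vector \<Rightarrow> real"
  assumes p: "sublinear p"
  obtains L where "linear L" "L \<le> p" "L y = p y"
proof -
  obtain q where q: "sublinear q" "q \<le> p" "q (- y) \<le> - p y"
    using sublinear_peak[OF p] by blast
  obtain L where L: "linear L" "L \<le> q"
    using sublinear_dominates_linear[OF q(1)] by blast
  have "- L y \<le> - p y"
    using L(2) q(3) linear_neg[OF L(1), of y] by (metis le_funD order_trans)
  moreover have "L \<le> p"
    using L(2) q(2) by (rule order_trans)
  ultimately show thesis
    using that[OF L(1)] by (simp add: le_fun_def antisym)
qed

section \<open>Bounded families in reflexive spaces\<close>

text \<open>A substitute for weak sequential compactness: \<open>x\<close> lies in every closed half-space that
  eventually contains \<open>u\<close>.\<close>

lemma reflexive_bounded_half_spaces: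
  fixes u :: "'b \<Rightarrow> 'a::real_normed_vector"
  assumes refl: "reflexive_space TYPE('a)" and F: "F \<noteq> bot"
    and M: "\<forall>\<^sub>F k in F. norm (u k) \<le> M"
  obtains x where
    "\<And>(g :: 'a \<Rightarrow>\<^sub>L real) c. \<forall>\<^sub>F k in F. blinfun_apply g (u k) \<le> c \<Longrightarrow> blinfun_apply g x \<le> c"
proof -
  \<comment> \<open>\<open>Inf (S g)\<close> is the upper limit of \<open>g\<close> along
    \<open>u\<close>, written as an infimum of eventual upper bounds so that
    \<open>sublinear_Inf\<close> applies.\<close>
  define S where "S g = {c. \<forall>\<^sub>F k in F. blinfun_apply g (u k) \<le> c}" for g :: "'a \<Rightarrow>\<^sub>L real"
  have bound: "\<forall>\<^sub>F k in F. \<bar>blinfun_apply g (u k)\<bar> \<le> norm g * M" for g :: "'a \<Rightarrow>\<^sub>L real"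
    using M
  proof eventually_elim
    case (elim k)
    then show ?case
      using norm_blinfun[of g "u k"] mult_left_mono[OF elim, of "norm g"] by simp
  qed
  have mem: "norm g * M \<in> S g" for g
    unfolding S_def using bound[of g] by (auto elim: eventually_mono)
  have bdd: "bdd_below (S g)" for g
  proof (rule bdd_belowI)
    fix c assume "c \<in> S g"
    then have "\<forall>\<^sub>F k in F. - (norm g * M) \<le> c"
      using bound[of g] unfolding S_def mem_Collect_eq by eventually_elim linarith
    \<comment> \<open>The inequality does not involve \<open>k\<close>, so holding eventually along
      a nontrivial filter means holding.\<close>
    then show "- (norm g * M) \<le> c"
      using F by simp
  qed
  have "sublinear (\<lambda>g. Inf (S g))"
  proof (rule sublinear_Inf[OF _ bdd])
    show "S g \<noteq> {}" for g
      using mem by blast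
  next
    fix g h a b assume "a \<in> S g" "b \<in> S h"
    then have "\<forall>\<^sub>F k in F. blinfun_apply (g + h) (u k) \<le> a + b"
      unfolding S_def mem_Collect_eq by eventually_elim (simp add: blinfun.add_left)
    then show "\<exists>d\<in>S (g + h). d \<le> a + b"
      unfolding S_def by blast
  next
    fix g a c assume "a \<in> S g" "(c::real) > 0"
    then have "\<forall>\<^sub>F k in F. blinfun_apply (c *\<^sub>R g) (u k) \<le> c * a"
      unfolding S_def mem_Collect_eq by (auto elim: eventually_mono simp: blinfun.scaleR_left)
    then show "\<exists>d\<in>S (c *\<^sub>R g). d \<le> c * a"
      unfolding S_def by blast
  qed
  then obtain \<phi> where \<phi>: "linear \<phi>" "\<phi> \<le> (\<lambda>g. Inf (S g))"
    by (rule sublinear_dominates_linear)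
  have le: "\<phi> g \<le> c" if "c \<in> S g" for g c
    using le_funD[OF \<phi>(2), of g] cInf_lower[OF that bdd] by linarith
  \<comment> \<open>The eventual bounds for \<open>g\<close> and \<open>- g\<close> together place
    \<phi> in the bidual.\<close>
  have "\<bar>\<phi> g\<bar> \<le> norm g * M" for g
    using le[OF mem[of g]] le[OF mem[of "- g"]] linear_neg[OF \<phi>(1), of g] by simp
  then have "bounded_linear \<phi>"
    using \<phi>(1) by (intro bounded_linear.intro bounded_linear_axioms.intro) auto
  moreover obtain x where "Blinfun \<phi> = canonical_embedding x"
    using refl unfolding reflexive_space_def by (metis surjD)
  ultimately have "\<phi> g = blinfun_apply g x" for g
    by (metis bounded_linear_Blinfun_apply canonical_embedding_apply)
  then show thesis
    using that[of x] le by (simp add: S_def)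
qed

section \<open>Existence of a minimizer\<close>

lemma reflexive_minimizer_exists:
  fixes f :: "'a::real_normed_vector \<Rightarrow> real"
  assumes refl: "reflexive_space TYPE('a)"
    and coercive: "filterlim f at_top at_infinity" and lower: "bdd_below (range f)"
    and subgradient: "\<And>x. \<exists>g :: 'a \<Rightarrow>\<^sub>L real. \<forall>u. f x + blinfun_apply g (u - x) \<le> f u"
  shows "global_minimizers f \<noteq> {}"
proof -
  define m where "m = Inf (range f)"
  have "\<exists>u. f u < m + 1 / real (Suc k)" for k
    using cInf_lessD[of "range f" "m + 1 / real (Suc k)"] by (auto simp: m_def)
  then obtain u where u: "\<And>k. f (u k) < m + 1 / real (Suc k)"
    by metis
  have ev: "\<forall>\<^sub>F k in sequentially. f (u k) \<le> m + e" if "e > 0" for e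
  proof -
    have "\<forall>\<^sub>F k in sequentially. 1 / real (Suc k) < e"
      using LIMSEQ_inverse_real_of_nat that by (auto simp: inverse_eq_divide dest: order_tendstoD(2))
    then show ?thesis
    proof eventually_elim
      case (elim k)
      then show ?case
        using u[of k] by linarith
    qed
  qed
  \<comment> \<open>From radius \<open>M\<close> on, \<open>f\<close> exceeds \<open>m + 1\<close>,
    so the tail with \<open>f (u k) \<le> m + 1\<close> is bounded.\<close>
  obtain M where M: "\<And>w. M \<le> norm w \<Longrightarrow> m + 1 < f w"
    using filterlim_at_top_dense[THEN iffD1, OF coercive] unfolding eventually_at_infinity by blast
  have "\<forall>\<^sub>F k in sequentially. norm (u k) \<le> M"
    using ev[OF zero_less_one] by eventually_elim (meson M linorder_not_le nle_le)
  then obtain x where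
    x: "\<And>(g :: 'a \<Rightarrow>\<^sub>L real) c. \<forall>\<^sub>F k in sequentially. blinfun_apply g (u k) \<le> c \<Longrightarrow> blinfun_apply g x \<le> c"
    using reflexive_bounded_half_spaces[OF refl sequentially_bot] by blast
  obtain g :: "'a \<Rightarrow>\<^sub>L real" where g: "\<And>u. f x + blinfun_apply g (u - x) \<le> f u"
    using subgradient by blast
  have "f x \<le> m + e" if "e > 0" for e
  proof -
    \<comment> \<open>The subgradient at \<open>x\<close> turns near-minimality of
      \<open>u k\<close> into a half-space constraint. The point \<open>x\<close> inherits it, and
      the value of \<open>g\<close> at \<open>x\<close> cancels. This replaces weak lower
      semicontinuity.\<close>
    have "\<forall>\<^sub>F k in sequentially. blinfun_apply g (u k) \<le> m + e - f x + blinfun_apply g x"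
      using ev[OF that]
    proof eventually_elim
      case (elim k)
      then show ?case
        using g[of "u k"] by (simp add: blinfun.diff_right)
    qed
    from x[OF this] show ?thesis
      by simp
  qed
  then have "f x \<le> m"
    by (rule field_le_epsilon)
  then have "f x \<le> f w" for w
    using cInf_lower[OF rangeI lower, of w] by (simp add: m_def)
  then show ?thesis
    by (auto simp: global_minimizers_def)
qed

section \<open>Closedness, convexity and uniqueness\<close>

lemma closed_global_minimizers:
  fixes f :: "'a::topological_space \<Rightarrow> real"
  assumes "continuous_on UNIV f"
  shows "closed (global_minimizers f)"
  unfolding global_minimizers_def using assms
  by (intro closed_Collect_all closed_Collect_le) (auto intro: continuous_intros)

lemma convex_global_minimizers:
  assumes "convex_on UNIV f"
  shows "convex (global_minimizers f)"
proof (rule convexI)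
  fix x y and s t :: real
  assume xy: "x \<in> global_minimizers f" "y \<in> global_minimizers f" and st: "0 \<le> s" "0 \<le> t" "s + t = 1"
  have "f (s *\<^sub>R x + t *\<^sub>R y) \<le> s * f x + t * f y"
    using assms st by (auto simp: convex_on_def)
  also have "f y = f x"
    using xy by (auto simp: global_minimizers_def intro: antisym)
  also have "s * f x + t * f x = f x"
    using st(3) by (metis distrib_right mult_1)
  finally show "s *\<^sub>R x + t *\<^sub>R y \<in> global_minimizers f"
    using xy(1) by (auto simp: global_minimizers_def intro: order_trans)
qed

lemma strictly_convex_global_minimizers_unique:
  assumes f: "strictly_convex_on UNIV f"
    and x: "x \<in> global_minimizers f" and y: "y \<in> global_minimizers f"
  shows "x = y"
proof (rule ccontr)
  assume "x \<noteq> y"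
  then have "f ((1/2) *\<^sub>R x + (1 - 1/2) *\<^sub>R y) < 1/2 * f x + (1 - 1/2) * f y"
    using f unfolding strictly_convex_on_def
    by (elim conjE ballE[of _ _ x] ballE[of _ _ y] ballE[of _ _ "1/2"]) auto
  moreover have "f y = f x" "f x \<le> f ((1/2) *\<^sub>R x + (1 - 1/2) *\<^sub>R y)"
    using x y by (auto simp: global_minimizers_def intro: antisym)
  ultimately show False
    by simp
qed

section \<open>The distance from the diagonal to \<open>v\<close>\<close>

theorem proposition4p1:
  fixes v :: "('a::banach) ^ 'n::finite"
    and N :: "'a ^ 'n \<Rightarrow> real"
    and f :: "'a \<Rightarrow> real"
  assumes "reflexive_space TYPE('a)"
    and "CARD('n) \<ge> 2"
    and "inj (\<lambda>i. v $ i)"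
    and "is_norm N"
    and "\<And>u. f u = N (\<chi> i. u - v $ i)"
    and "filterlim f at_top at_infinity"
    and "\<exists>\<gamma>>0. \<forall>u. N (\<chi> i. u) \<le> \<gamma> * norm u"
  shows "global_minimizers f \<noteq> {} \<and> closed (global_minimizers f) \<and> convex (global_minimizers f)
    \<and> (strictly_convex_on UNIV f \<longrightarrow> is_singleton (global_minimizers f))"
proof -
  \<comment> \<open>With the diagonal map \<open>D\<close>, \<open>f\<close> becomes
    \<open>N\<close> composed with an affine map.\<close>
  define D :: "'a \<Rightarrow> 'a ^ 'n" where "D u = (\<chi> i. u)" for u
  have D: "linear D"
    by (rule linearI) (simp_all add: D_def vec_eq_iff)
  have f: "f u = N (D u - v)" for u
    unfolding assms(5) D_def by (rule arg_cong[of _ _ N]) (simp add: vec_eq_iff)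
  obtain \<gamma> where \<gamma>: "\<gamma> > 0" "\<And>u. N (D u) \<le> \<gamma> * norm u"
    using assms(7) by (auto simp: D_def)
  have nonneg: "0 \<le> N y" and scale: "N (c *\<^sub>R y) = \<bar>c\<bar> * N y" and tri: "N (y + z) \<le> N y + N z" for c y z
    using assms(4) by (auto simp: is_norm_def)
  have N: "sublinear N"
    unfolding sublinear_def by (simp add: scale tri)
  \<comment> \<open>\<open>D u - v\<close> is the sum of \<open>D w - v\<close> and
    \<open>D (u - w)\<close>; the diagonal bound controls the second term.\<close>
  have lip: "f u \<le> f w + \<gamma> * norm (u - w)" for u w
    using tri[of "D w - v" "D (u - w)"] \<gamma>(2)[of "u - w"] by (simp add: f linear_diff[OF D])
  have "\<gamma>-lipschitz_on UNIV f"
  proof (rule lipschitz_onI)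
    show "dist (f u) (f w) \<le> \<gamma> * dist u w" for u w
      using lip[of u w] lip[of w u] by (simp add: dist_norm norm_minus_commute abs_le_iff)
  qed (use \<gamma> in simp)
  then have "closed (global_minimizers f)"
    by (intro closed_global_minimizers lipschitz_on_continuous_on)
  moreover have "convex_on UNIV f"
  proof (rule convex_onI)
    fix t x y assume t: "0 < t" "(t::real) < 1"
    have "D ((1 - t) *\<^sub>R x + t *\<^sub>R y) - v = (1 - t) *\<^sub>R (D x - v) + t *\<^sub>R (D y - v)"
      unfolding linear_add[OF D] linear_scale[OF D] by (simp add: algebra_simps)
    then show "f ((1 - t) *\<^sub>R x + t *\<^sub>R y) \<le> (1 - t) * f x + t * f y"
      using tri[of "(1 - t) *\<^sub>R (D x - v)" "t *\<^sub>R (D y - v)"] t by (simp add: f scale)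
  qed simp
  then have "convex (global_minimizers f)"
    by (rule convex_global_minimizers)
  moreover have "global_minimizers f \<noteq> {}"
  proof (rule reflexive_minimizer_exists[OF assms(1,6)])
    show "bdd_below (range f)"
      using nonneg by (intro bdd_belowI2[of _ 0]) (simp add: f)
  next
    fix x
    obtain L where L: "linear L" "L \<le> N" "L (D x - v) = N (D x - v)"
      using sublinear_supporting_linear[OF N] by blast
    \<comment> \<open>\<open>L\<close> is controlled only by \<open>N\<close>, which may be
      unrelated to the type class norm; on the diagonal \<gamma> links the two.\<close>
    have "\<bar>L (D u)\<bar> \<le> norm u * \<gamma>" for u
      using le_funD[OF L(2), of "D u"] le_funD[OF L(2), of "D (- u)"] \<gamma>(2)[of u] \<gamma>(2)[of "- u"]
      by (simp add: linear_neg[OF D] linear_neg[OF L(1)] mult.commute abs_le_iff)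
    then have "bounded_linear (L \<circ> D)"
      using linear_compose[OF D L(1)]
      by (intro bounded_linear.intro bounded_linear_axioms.intro) auto
    then have g: "blinfun_apply (Blinfun (L \<circ> D)) u = L (D u)" for u
      by (simp add: bounded_linear_Blinfun_apply)
    \<comment> \<open>\<open>L\<close> equals \<open>f x\<close> at \<open>D x - v\<close> and is at
      most \<open>f u\<close> at \<open>D u - v\<close>; \<open>v\<close> cancels in the
      difference.\<close>
    have "f x + L (D (u - x)) \<le> f u" for u
      using le_funD[OF L(2), of "D u - v"] L(3)
      by (simp add: f linear_diff[OF L(1)] linear_diff[OF D])
    then show "\<exists>g :: 'a \<Rightarrow>\<^sub>L real. \<forall>u. f x + blinfun_apply g (u - x) \<le> f u"
      using g by metis
  qed
  moreover have "is_singleton (global_minimizers f)" if "strictly_convex_on UNIV f"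
    \<comment> \<open>The fact \<open>calculation(3)\<close> is nonemptiness.\<close>
    using calculation(3) strictly_convex_global_minimizers_unique[OF that]
    by (meson all_not_in_conv is_singletonI')
  ultimately show ?thesis
    by blast
qed

end
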